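(* For every integer $d>2$ and every integer $s$ with $2\leq s\leq d-1$, $$\max(G_d^s)<\mathsf{g}^{s+1}-1\quad\Longleftrightarrow\quad \frac{2d+1-\sqrt{8d-15}}{2}<s\leq d-1 .$$ Thus, the integers in $[\max(G_d^s)+1,\ \mathsf{g}^{s+1}-1]$ are gaps in $R_d$, for $\frac{2d+1-\sqrt{8d-15}}{2}<s\leq d-1$.
   Context: Binomial expansion: for positive integers $a,t$ write uniquely $a=\binom{k(t)}{t}+\binom{k(t-1)}{t-1}+\cdots+\binom{k(j)}{j}$ with $k(t)>k(t-1)>\cdots>k(j)\geq j\geq 1$, and set $a^{\langle t\rangle}:=\binom{k(t)+1}{t+1}+\binom{k(t-1)+1}{t}+\cdots+\binom{k(j)+1}{j+1}$; also $0^{\langle t\rangle}:=0$. A function $\mathsf{h}:\mathbb{N}\to\mathbb{N}$ is an O-sequence if $\mathsf{h}(0)=1$ and $\mathsf{h}(t+1)\leq \mathsf{h}(t)^{\langle t\rangle}$ for every $t\geq 1$. It is finite if $\mathsf{h}(t)=0$ for some $t$ (and then for all larger arguments); a finite O-sequence is written $(h_0,\ldots,h_{s-1})$ with $h_{s-1}\neq 0$, $s$ is its length, and $\sum_{i=0}^{s-1}h_i$ is its multiplicity. $\mathcal{G}_d$ is the set of finite O-sequences of multiplicity $d$ and $\mathcal{G}_d^s$ the subset of those of length $s$. The genus of $\mathsf{h}=(h_0,\ldots,h_{s-1})$ is $g(\mathsf{h}):=\sum_{j=2}^{s-1}(j-1)h_j$. Set $G_d:=\{g(\mathsf{h})\mid\mathsf{h}\in\mathcal{G}_d\}$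 and $G_d^s:=\{g(\mathsf{h})\mid\mathsf{h}\in\mathcal{G}_d^s\}$; these are the sets of arithmetic genera of arithmetically Cohen-Macaulay projective curves of degree $d$ (respectively, of degree $d$ with $h$-vector of length $s$). Set $\mathsf{g}^s:=\binom{s-1}{2}$ (the minimum of $G_d^s$). $[a,b]$ denotes the set of integers $n$ with $a\leq n\leq b$; $R_d:=[0,\binom{d-1}{2}]$, and $G_d\subseteq R_d$. A gap in $R_d$ is an integer in $R_d\setminus G_d$. *)

theory Defs
  imports Complex_Main
begin

definition binomial_expansion :: "nat \<Rightarrow> nat \<Rightarrow> nat \<Rightarrow> (nat \<Rightarrow> nat) \<Rightarrow> bool" where
  "binomial_expansion a t j k \<longleftrightarrow>
     1 \<le> j \<and> j \<le> t \<and> j \<le> k j \<and> strict_mono_on {j..t} k \<and>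
     a = (\<Sum>i=j..t. k i choose i)"

(* For a, t >= 1 the expansion exists and is unique (as j and k restricted to {j..t}),
   so the definite description below is well defined. The value is only meant for t >= 1. *)
definition macaulay_bound :: "nat \<Rightarrow> nat \<Rightarrow> nat" where
  "macaulay_bound a t =
     (if a = 0 then 0
      else (THE b. \<exists>j k. binomial_expansion a t j k \<and>
                         b = (\<Sum>i=j..t. (k i + 1) choose (i + 1))))"

definition O_sequence :: "(nat \<Rightarrow> nat) \<Rightarrow> bool" where
  "O_sequence h \<longleftrightarrow> h 0 = 1 \<and> (\<forall>t\<ge>1. h (t + 1) \<le> macaulay_bound (h t) t)"

definition finite_O_sequence :: "(nat \<Rightarrow> nat) \<Rightarrow> bool" where
  "finite_O_sequence h \<longleftrightarrow> O_sequence h \<and> (\<exists>t. h t = 0)"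

(* Since the Macaulay bound of 0 is 0, a finite O-sequence vanishes from its first zero on;
   hence its length is the position of the first zero. *)
definition seq_length :: "(nat \<Rightarrow> nat) \<Rightarrow> nat" where
  "seq_length h = (LEAST t. h t = 0)"

definition multiplicity :: "(nat \<Rightarrow> nat) \<Rightarrow> nat" where
  "multiplicity h = (\<Sum>i<seq_length h. h i)"

definition genus :: "(nat \<Rightarrow> nat) \<Rightarrow> int" where
  "genus h = (\<Sum>j=2..<seq_length h. (int j - 1) * int (h j))"

definition O_sequences :: "nat \<Rightarrow> (nat \<Rightarrow> nat) set" where
  "O_sequences d = {h. finite_O_sequence h \<and> multiplicity h = d}"

definition O_sequences_of_length :: "nat \<Rightarrow> nat \<Rightarrow> (nat \<Rightarrow> nat) set" where
  "O_sequences_of_length d s = {h \<in> O_sequences d. seq_length h = s}"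

definition genera :: "nat \<Rightarrow> int set" where
  "genera d = genus ` O_sequences d"

definition genera_of_length :: "nat \<Rightarrow> nat \<Rightarrow> int set" where
  "genera_of_length d s = genus ` O_sequences_of_length d s"

definition min_genus :: "nat \<Rightarrow> int" where
  "min_genus s = int ((s - 1) choose 2)"

definition genus_range :: "nat \<Rightarrow> int set" where
  "genus_range d = {0..int ((d - 1) choose 2)}"

definition gaps :: "nat \<Rightarrow> int set" where
  "gaps d = genus_range d - genera d"

end

(* Write h = (1, 1 + y_0, ..., 1 + y_(n-1)) with n = s - 1 and e = d - s, so that the y_j sum up to e
   and the genus is (n choose 2) + (sum of j * y_j). As h stays at most 1 once it takes the value 1
   in positive degree, the support of y is an initial segment; hence j <= y_0 + ... + y_(j-1)
   whenever y_j > 0, which yields (sum of j * y_j) <= (e choose 2). If e <= n, this is attained by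
   (1, 2, ..., 2, 1, ..., 1), so everything reduces to comparing (e choose 2) with n - 1.
   For the gaps, longer sequences have genus at least (n + 1 choose 2), and shorter ones
   have genus at most the maximum for length s, by convexity of the binomial coefficient. *)
theory Submission
  imports Defs
begin

section \<open>The binomial coefficient \<open>n choose 2\<close>\<close>

lemma double_choose_two: "2 * int (n choose 2) = int n * (int n - 1)"
  by (induction n) (auto simp: numeral_2_eq_2 algebra_simps)

lemma sum_lessThan_eq_choose_two: "(\<Sum>j<n. j) = n choose 2"
  by (induction n) (auto simp: numeral_2_eq_2)

lemma pred_le_choose_two: "n - 1 \<le> n choose 2"
  by (induction n) (auto simp: numeral_2_eq_2)

section \<open>Values of the Macaulay bound: small arguments and degree one\<close>

lemma binomial_expansion_ge:
  assumes "binomial_expansion a t j k" "i \<in> {j..t}"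
  shows "i \<le> k i"
proof -
  have mono: "strict_mono_on {j..t} k" and kj: "j \<le> k j"
    using assms by (auto simp: binomial_expansion_def)
  have "j \<le> i" "i \<le> t" using assms by auto
  then show ?thesis
  proof (induction i rule: dec_induct)
    case base
    show ?case by (rule kj)
  next
    case (step i)
    then have "k i < k (Suc i)"
      by (intro strict_mono_onD[OF mono]) auto
    with step show ?case by simp
  qed
qed

text \<open>If some \<open>k i\<close> exceeds \<open>i\<close>, strict monotonicity carries the
  strict inequality up to the top index; the single term \<open>k t choose t\<close> is then at
  least \<open>Suc t choose t\<close>, that is t + 1, which is more than \<open>a\<close>.\<close>

lemma binomial_expansion_small:
  assumes "binomial_expansion a t j k" "a \<le> t" "i \<in> {j..t}"
  shows "k i = i"
proof (rule ccontr)
  assume "k i \<noteq> i"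
  have mono: "strict_mono_on {j..t} k" and jt: "1 \<le> j" "j \<le> t"
    and a: "a = (\<Sum>i=j..t. k i choose i)"
    using assms by (auto simp: binomial_expansion_def)
  have "i < k i"
    using binomial_expansion_ge[OF assms(1,3)] \<open>k i \<noteq> i\<close> by simp
  have "i \<le> t" "j \<le> i" using assms(3) by auto
  from this(1) have "t < k t"
  proof (induction t rule: dec_induct)
    case base
    show ?case by fact
  next
    case (step m)
    then have "k m < k (Suc m)"
      using \<open>j \<le> i\<close> by (intro strict_mono_onD[OF mono]) auto
    with step show ?case by simp
  qed
  then have "Suc t choose t \<le> k t choose t"
    by (intro binomial_right_mono) auto
  also have "\<dots> \<le> a"
    unfolding a using jt by (intro member_le_sum) auto
  finally show False using assms(2) by simp
qed

text \<open>For a > 0 the expansion consists of the \<open>a\<close> terms \<open>i choose i\<close>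
  with i from t - a + 1 to t, and raising both entries of each by one leaves its value 1. Every
  other expansion also has \<open>k i = i\<close>, so the definite description can be
  evaluated.\<close>

lemma macaulay_bound_small:
  assumes "a \<le> t"
  shows "macaulay_bound a t = a"
proof (cases "a = 0")
  case False
  define j where "j = t - a + 1"
  have exp: "binomial_expansion a t j (\<lambda>i. i)"
    using assms False by (auto simp: binomial_expansion_def j_def strict_mono_on_def)
  have "(THE b. \<exists>j k. binomial_expansion a t j k \<and>
          b = (\<Sum>i=j..t. (k i + 1) choose (i + 1))) = a"
  proof (rule the_equality)
    show "\<exists>j k. binomial_expansion a t j k \<and> a = (\<Sum>i=j..t. (k i + 1) choose (i + 1))"
      using exp assms False by (intro exI[of _ j] exI[of _ "\<lambda>i. i"]) (auto simp: j_def)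
  next
    fix b
    assume "\<exists>j k. binomial_expansion a t j k \<and> b = (\<Sum>i=j..t. (k i + 1) choose (i + 1))"
    then obtain j k where jk: "binomial_expansion a t j k"
      and b: "b = (\<Sum>i=j..t. (k i + 1) choose (i + 1))" by blast
    have "a = (\<Sum>i=j..t. k i choose i)"
      using jk by (simp add: binomial_expansion_def)
    also have "\<dots> = (\<Sum>i=j..t. (k i + 1) choose (i + 1))"
      using binomial_expansion_small[OF jk assms] by (intro sum.cong) auto
    finally show "b = a" using b by simp
  qed
  then show ?thesis using False by (simp add: macaulay_bound_def)
qed (simp add: macaulay_bound_def)

text \<open>In degree one an expansion has the single term \<open>a choose 1\<close>. This covers
  the step from degree 1 to degree 2, where the value may exceed the degree.\<close>

lemma macaulay_bound_degree_one: "macaulay_bound a 1 = Suc a choose 2"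
proof (cases "a = 0")
  case False
  have "(THE b. \<exists>j k. binomial_expansion a 1 j k \<and>
          b = (\<Sum>i=j..1. (k i + 1) choose (i + 1))) = Suc a choose 2"
  proof (rule the_equality)
    show "\<exists>j k. binomial_expansion a 1 j k \<and>
            Suc a choose 2 = (\<Sum>i=j..1. (k i + 1) choose (i + 1))"
      using False
      by (intro exI[of _ 1] exI[of _ "\<lambda>i. a"])
        (auto simp: binomial_expansion_def strict_mono_on_def numeral_2_eq_2)
  next
    fix b
    assume "\<exists>j k. binomial_expansion a 1 j k \<and> b = (\<Sum>i=j..1. (k i + 1) choose (i + 1))"
    then obtain j k where jk: "binomial_expansion a 1 j k"
      and b: "b = (\<Sum>i=j..1. (k i + 1) choose (i + 1))" by blast
    have "j = 1" "k 1 = a"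
      using jk by (auto simp: binomial_expansion_def le_antisym)
    then show "b = Suc a choose 2" using b by (simp add: numeral_2_eq_2)
  qed
  then show ?thesis using False by (simp add: macaulay_bound_def)
qed (simp add: macaulay_bound_def)

section \<open>O-sequences of given length: bounds on the genus and a witness\<close>

lemma O_sequence_le_one:
  assumes "O_sequence h" "1 \<le> i" "i \<le> j" "h i \<le> 1"
  shows "h j \<le> 1"
  using assms(3,4)
proof (induction j rule: dec_induct)
  case base
  then show ?case .
next
  case (step j)
  have "h (Suc j) \<le> macaulay_bound (h j) j"
    using assms(1,2) step.hyps by (auto simp: O_sequence_def)
  \<comment> \<open>A value at most 1 in degree j \<ge> 1 is a small argument, so the bound is the
    value itself.\<close>
  also have "\<dots> = h j"
    using assms(2) step by (intro macaulay_bound_small) simp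
  also have "\<dots> \<le> 1" using step by simp
  finally show ?case .
qed

lemma genus_eq_shifted_sum:
  assumes "seq_length h = Suc n"
  shows "genus h = (\<Sum>j<n. int j * int (h (Suc j)))"
proof -
  \<comment> \<open>The term at j = 1 has weight 0, so the sum may start there.\<close>
  have "genus h = (\<Sum>j=1..<Suc n. (int j - 1) * int (h j))"
    unfolding genus_def assms by (cases n) (auto simp: sum.atLeast_Suc_lessThan numeral_2_eq_2)
  also have "\<dots> = (\<Sum>j<n. int j * int (h (Suc j)))"
    unfolding One_nat_def sum.shift_bounds_Suc_ivl by (simp add: atLeast0LessThan)
  finally show ?thesis .
qed

text \<open>Here \<open>y j\<close> is the excess of \<open>h (Suc j)\<close> over 1. Splitting off
  the ones leaves \<open>Suc n\<close> in the multiplicity and the sum of all j < n in the genus;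
  the support condition restates \<open>O_sequence_le_one\<close>.\<close>

lemma finite_O_sequence_excess:
  assumes "h \<in> O_sequences d"
  obtains n y where "seq_length h = Suc n" "d = Suc n + (\<Sum>j<n. y j)"
    "\<And>i j. i < j \<Longrightarrow> 0 < y j \<Longrightarrow> 0 < y i"
    "genus h = int ((n choose 2) + (\<Sum>j<n. j * y j))"
proof -
  have O: "O_sequence h" and ex: "\<exists>t. h t = 0" and mult: "multiplicity h = d"
    using assms by (auto simp: O_sequences_def finite_O_sequence_def)
  have h0: "h 0 = 1" using O by (simp add: O_sequence_def)
  have "h (seq_length h) = 0"
    unfolding seq_length_def using ex by (rule LeastI_ex)
  then obtain n where n: "seq_length h = Suc n"
    using h0 by (cases "seq_length h") auto
  \<comment> \<open>Truncated subtraction gives 0 also where \<open>h\<close> vanishes, so the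
    support condition holds for all indices.\<close>
  define y where "y j = h (Suc j) - 1" for j
  have h: "h (Suc j) = Suc (y j)" if "j < n" for j
  proof -
    have "h (Suc j) \<noteq> 0"
      using that n not_less_Least[of "Suc j" "\<lambda>t. h t = 0"] by (simp add: seq_length_def)
    then show ?thesis by (simp add: y_def)
  qed
  have "d = h 0 + (\<Sum>j<n. h (Suc j))"
    using mult by (simp add: multiplicity_def n sum.lessThan_Suc_shift del: sum.lessThan_Suc)
  also have "\<dots> = Suc n + (\<Sum>j<n. y j)"
    by (simp add: h0 h sum_Suc)
  finally have d: "d = Suc n + (\<Sum>j<n. y j)" .
  have supp: "0 < y i" if "i < j" "0 < y j" for i j
    using O_sequence_le_one[OF O, of "Suc i" "Suc j"] that by (force simp: y_def)
  have "genus h = (\<Sum>j<n. int j * int (h (Suc j)))"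
    using n by (rule genus_eq_shifted_sum)
  also have "\<dots> = int (\<Sum>j<n. j + j * y j)"
    unfolding of_nat_sum by (intro sum.cong) (auto simp: h algebra_simps)
  also have "\<dots> = int ((n choose 2) + (\<Sum>j<n. j * y j))"
    by (simp only: sum.distrib sum_lessThan_eq_choose_two)
  finally show ?thesis using that n d supp by blast
qed

text \<open>Induction on n. With E the sum of the first n entries, adding \<open>y n\<close> raises
  \<open>E choose 2\<close> by \<open>E * y n + (y n choose 2)\<close>; if \<open>y n\<close> is
  positive, then so are the n earlier entries, whence n \<le> E.\<close>

lemma weighted_sum_le_choose_two:
  fixes y :: "nat \<Rightarrow> nat"
  assumes "\<And>i j. i < j \<Longrightarrow> 0 < y j \<Longrightarrow> 0 < y i"
  shows "(\<Sum>j<n. j * y j) \<le> (\<Sum>j<n. y j) choose 2"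
proof -
  have "2 * int (\<Sum>j<n. j * y j) \<le> 2 * int ((\<Sum>j<n. y j) choose 2)"
  proof (induction n)
    case (Suc n)
    define E where "E = (\<Sum>j<n. y j)"
    have IH: "2 * int (\<Sum>j<n. j * y j) \<le> int E * (int E - 1)"
      using Suc by (simp add: double_choose_two E_def)
    show ?case
    proof (cases "y n = 0")
      case True
      then show ?thesis using Suc by simp
    next
      case False
      have "(\<Sum>j<n. 1) \<le> E"
        unfolding E_def using assms[of _ n] False by (intro sum_mono) (simp add: Suc_leI)
      then have "int n * int (y n) \<le> int E * int (y n)"
        by (intro mult_right_mono) auto
      moreover have "1 * int (y n) \<le> int (y n) * int (y n)"
        using False by (intro mult_right_mono) auto
      ultimately show ?thesis
        using IH by (simp add: double_choose_two algebra_simps flip: E_def)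
    qed
  qed simp
  then show ?thesis by linarith
qed

text \<open>The third bound is the sharp one when the excess is at most n. The fourth replaces every
  weight by the largest one, n - 1, and serves short sequences with large excess.\<close>

lemma genus_of_length_bounds:
  assumes "h \<in> O_sequences d" "seq_length h = Suc n"
  shows "Suc n \<le> d" "int (n choose 2) \<le> genus h"
    "genus h \<le> int ((n choose 2) + (d - Suc n choose 2))"
    "genus h \<le> int ((n choose 2) + (n - 1) * (d - Suc n))"
proof -
  obtain y where d: "d = Suc n + (\<Sum>j<n. y j)"
    and supp: "\<And>i j. i < j \<Longrightarrow> 0 < y j \<Longrightarrow> 0 < y i"
    and g: "genus h = int ((n choose 2) + (\<Sum>j<n. j * y j))"
    using finite_O_sequence_excess[OF assms(1)] assms(2) by (metis Suc_inject)
  show "Suc n \<le> d" using d by simp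
  show "int (n choose 2) \<le> genus h" unfolding g by (simp only: of_nat_le_iff le_add1)
  show "genus h \<le> int ((n choose 2) + (d - Suc n choose 2))"
    using weighted_sum_le_choose_two[of y n] supp unfolding g of_nat_le_iff by (simp add: d)
  have "(\<Sum>j<n. j * y j) \<le> (\<Sum>j<n. (n - 1) * y j)"
    by (intro sum_mono mult_right_mono) auto
  then show "genus h \<le> int ((n choose 2) + (n - 1) * (d - Suc n))"
    unfolding g of_nat_le_iff by (simp add: d sum_distrib_left)
qed

text \<open>Finiteness gives \<open>Max\<close> its intended meaning.\<close>

lemma finite_genera_of_length: "finite (genera_of_length d (Suc n))"
proof (rule finite_subset)
  show "genera_of_length d (Suc n) \<subseteq> {int (n choose 2)..int ((n choose 2) + (d - Suc n choose 2))}"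
    using genus_of_length_bounds
    by (fastforce simp: genera_of_length_def O_sequences_of_length_def)
qed simp

text \<open>With m = min e n the witness is (1, e - m + 2, 2, ..., 2, 1, ..., 1), where m entries
  exceed 1. Surplus excess sits in degree 1, which has weight 0 in the genus. For e \<le> n this
  attains the upper bound; for e > n it still yields twice \<open>n choose 2\<close>.\<close>

lemma genera_of_length_witness:
  assumes "1 \<le> n" "1 \<le> e"
  shows "int ((n choose 2) + (min e n choose 2)) \<in> genera_of_length (Suc n + e) (Suc n)"
proof -
  define m where "m = min e n"
  have m: "1 \<le> m" "m \<le> n" "m \<le> e" using assms by (auto simp: m_def)
  define y where "y j = (if j = 0 then Suc (e - m) else if j < m then 1 else 0)" for j :: nat
  define h where "h i = (case i of 0 \<Rightarrow> 1 | Suc j \<Rightarrow> if j < n then Suc (y j) else 0)" for i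
  have O: "O_sequence h"
    unfolding O_sequence_def
  proof (intro conjI allI impI)
    fix t :: nat
    assume "1 \<le> t"
    show "h (t + 1) \<le> macaulay_bound (h t) t"
    \<comment> \<open>Only in degree 1 does the value exceed the degree, and there
      \<open>h 2 \<le> 2\<close> suffices. From degree 2 on the values are at most 2 and do not
      increase, so the bound equals the value.\<close>
    proof (cases "t = 1")
      case True
      define r where "r = e - m"
      have "h 1 = Suc (Suc r)" using m by (simp add: h_def y_def r_def)
      moreover have "h 2 \<le> 2" using m by (simp add: h_def y_def numeral_2_eq_2)
      ultimately show ?thesis
        unfolding True macaulay_bound_degree_one by (simp add: numeral_2_eq_2)
    next
      case False
      with \<open>1 \<le> t\<close> obtain i where t: "t = Suc (Suc i)"
        by (cases t; cases "t - 1") auto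
      have "h t \<le> t" by (auto simp: t h_def y_def)
      then have "macaulay_bound (h t) t = h t" by (rule macaulay_bound_small)
      then show ?thesis by (auto simp: t h_def y_def)
    qed
  qed (simp add: h_def)
  have len: "seq_length h = Suc n"
    unfolding seq_length_def
    by (rule Least_equality) (auto simp: h_def split: nat.splits if_splits intro!: Suc_leI)
  have sum_y: "(\<Sum>j<n. y j) = e" and sum_jy: "(\<Sum>j<n. j * y j) = m choose 2"
  proof -
    have "(\<Sum>j<n. y j) = (\<Sum>j<m. y j)"
      using m by (intro sum.mono_neutral_right) (auto simp: y_def)
    also have "\<dots> = (\<Sum>j\<in>insert 0 {1..<m}. y j)"
      using m by (intro sum.cong) auto
    also have "\<dots> = e" using m by (simp add: y_def)
    finally show "(\<Sum>j<n. y j) = e" .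
    have "(\<Sum>j<n. j * y j) = (\<Sum>j<m. j * y j)"
      using m by (intro sum.mono_neutral_right) (auto simp: y_def)
    also have "\<dots> = (\<Sum>j<m. j)" by (intro sum.cong) (auto simp: y_def)
    finally show "(\<Sum>j<n. j * y j) = m choose 2"
      by (simp only: sum_lessThan_eq_choose_two)
  qed
  have "multiplicity h = Suc (\<Sum>j<n. Suc (y j))"
    unfolding multiplicity_def len sum.lessThan_Suc_shift by (simp add: h_def)
  also have "\<dots> = Suc n + e" by (simp add: sum_Suc sum_y)
  finally have mult: "multiplicity h = Suc n + e" .
  have "h (Suc n) = 0" by (simp add: h_def)
  then have mem: "h \<in> O_sequences (Suc n + e)"
    using O mult by (auto simp: O_sequences_def finite_O_sequence_def)
  have "genus h = (\<Sum>j<n. int j * int (h (Suc j)))"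
    using len by (rule genus_eq_shifted_sum)
  also have "\<dots> = int (\<Sum>j<n. j + j * y j)"
    unfolding of_nat_sum by (intro sum.cong) (auto simp: h_def algebra_simps)
  also have "\<dots> = int ((n choose 2) + (m choose 2))"
    by (simp only: sum.distrib sum_lessThan_eq_choose_two sum_jy)
  finally show ?thesis
    using mem len unfolding genera_of_length_def O_sequences_of_length_def m_def
    by (metis (mono_tags, lifting) image_eqI mem_Collect_eq)
qed

section \<open>The threshold on s, and the genera of shorter sequences\<close>

lemma threshold_iff:
  fixes d s :: nat
  assumes "d > 2" "s \<le> d"
  shows "(2 * real d + 1 - sqrt (8 * real d - 15)) / 2 < real s
    \<longleftrightarrow> (d - s) * (d - s) + (d - s) + 4 < 2 * d"
proof -
  define e where "e = d - s"
  have e: "real s = real d - real e" using assms by (simp add: e_def of_nat_diff)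
  have "(2 * real d + 1 - sqrt (8 * real d - 15)) / 2 < real s
      \<longleftrightarrow> 2 * real e + 1 < sqrt (8 * real d - 15)"
    by (auto simp: e field_simps)
  \<comment> \<open>Squaring is an equivalence because \<open>2 * real e + 1\<close> is
    nonnegative.\<close>
  also have "\<dots> \<longleftrightarrow> (2 * real e + 1)\<^sup>2 < 8 * real d - 15"
    using real_less_rsqrt real_less_lsqrt[of "8 * real d - 15"] assms(1)
    by (metis (no_types, lifting) abs_of_nonneg add_nonneg_nonneg mult_nonneg_nonneg of_nat_0_le_iff
        real_sqrt_abs real_sqrt_less_iff zero_le_numeral zero_le_one)
  also have "\<dots> \<longleftrightarrow> real (e * e + e + 4) < real (2 * d)"
    by (auto simp: power2_eq_square algebra_simps)
  also have "\<dots> \<longleftrightarrow> e * e + e + 4 < 2 * d" by (rule of_nat_less_iff)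
  finally show ?thesis by (simp add: e_def)
qed

text \<open>Brings the square-root condition into the form that compares the largest possible
  contribution of the excess, \<open>e choose 2\<close>, with n - 1.\<close>

lemma threshold_iff_choose_two:
  fixes n e :: nat
  assumes "1 \<le> n" "1 \<le> e"
  shows "(2 * real (Suc n + e) + 1 - sqrt (8 * real (Suc n + e) - 15)) / 2 < real (Suc n)
    \<longleftrightarrow> (e choose 2) + 1 < n"
proof -
  have "(2 * real (Suc n + e) + 1 - sqrt (8 * real (Suc n + e) - 15)) / 2 < real (Suc n)
    \<longleftrightarrow> e * e + e + 4 < 2 * (Suc n + e)"
    using threshold_iff[of "Suc n + e" "Suc n"] assms by simp
  also have "\<dots> \<longleftrightarrow> int e * int e + int e + 4 < 2 * (int n + 1 + int e)"
    by (subst of_nat_less_iff[where 'a = int, symmetric])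
      (simp only: of_nat_add of_nat_mult of_nat_numeral of_nat_Suc, simp add: algebra_simps)
  also have "\<dots> \<longleftrightarrow> 2 * int (e choose 2) + 2 < 2 * int n"
    by (simp add: double_choose_two algebra_simps)
  finally show ?thesis by linarith
qed

text \<open>Let q be the excess, so p + q = n + e. If e \<le> p, both p and q lie between e and n,
  and convexity applies. If p < e, then q > n and the sum of \<open>p choose 2\<close> and
  \<open>q choose 2\<close> is too large, so the bound with weight p - 1 takes over.\<close>

lemma genus_le_of_shorter:
  assumes h: "h \<in> O_sequences (Suc n + e)" "seq_length h = Suc p"
    and p: "1 \<le> p" "p < n" and e: "(e choose 2) + 1 < n"
  shows "genus h \<le> int ((n choose 2) + (e choose 2))"
proof -
  define q where "q = n + e - p"
  have q: "int q = int n + int e - int p" using p by (simp add: q_def of_nat_diff)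
  have p1: "int (p - 1) = int p - 1" using p by (simp add: of_nat_diff)
  have e': "int e * (int e - 1) + 2 < 2 * int n"
    using e double_choose_two[of e] by linarith
  have bounds: "genus h \<le> int ((p choose 2) + (q choose 2))"
    "genus h \<le> int ((p choose 2) + (p - 1) * q)"
    using genus_of_length_bounds(3,4)[OF h] by (simp_all add: q_def)
  have "2 * genus h \<le> int n * (int n - 1) + int e * (int e - 1)"
  proof (cases "e \<le> p")
    case True
    have "2 * genus h \<le> int p * (int p - 1) + int q * (int q - 1)"
      using bounds(1) double_choose_two[of p] double_choose_two[of q] by simp
    also have "\<dots> = int n * (int n - 1) + int e * (int e - 1)
        - 2 * ((int n - int p) * (int p - int e))"
      by (simp add: q algebra_simps)
    also have "\<dots> \<le> int n * (int n - 1) + int e * (int e - 1)"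
      using True p by simp
    finally show ?thesis .
  next
    case False
    \<comment> \<open>The distance from p to e - 1, the largest p in this case. The expression in p
      below differs from its value at e - 1 by a nonnegative multiple of \<open>a\<close>.\<close>
    define a where "a = int e - 1 - int p"
    have a: "0 \<le> a" using False by (simp add: a_def)
    have "2 * genus h \<le> int p * (int p - 1) + 2 * ((int p - 1) * int q)"
      using bounds(2) double_choose_two[of p] p1 by simp
    also have "\<dots> = (int p - 1) * (2 * int n + 2 * int e - int p)"
      by (simp add: q algebra_simps)
    also have "\<dots> \<le> (int e - 2) * (2 * int n + int e + 1)"
    proof -
      have "(int e - 2) * (2 * int n + int e + 1) - (int p - 1) * (2 * int n + 2 * int e - int p)
          = a * (2 * int n + int e - int p + 2)"
        by (simp add: a_def algebra_simps)
      moreover have "0 \<le> a * (2 * int n + int e - int p + 2)"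
        using a p by (intro mult_nonneg_nonneg) auto
      ultimately show ?thesis by linarith
    qed
    also have "\<dots> \<le> int n * (int n - 1) + int e * (int e - 1)"
    proof -
      \<comment> \<open>No integer lies strictly between 2 and 3. Expanded, this says that
        \<open>e * (e - 1) + 2\<close> is at least 4e - 4, so \<open>e'\<close> gives 2n > 4e -
        4.\<close>
      have "0 \<le> (int e - 2) * (int e - 3)"
      proof (cases "e \<le> 2")
        case True
        then show ?thesis by (intro mult_nonpos_nonpos) auto
      next
        case False
        then show ?thesis by (intro mult_nonneg_nonneg) auto
      qed
      then have "0 \<le> int n - 2 * int e + 2"
        using e' by (simp add: algebra_simps)
      \<comment> \<open>The right side of the claim exceeds the left by
        \<open>(n + 1) * (n - 2 * e + 2) + 2 * e\<close>.\<close>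
      then have "0 \<le> (int n + 1) * (int n - 2 * int e + 2)" by simp
      then show ?thesis by (simp add: algebra_simps)
    qed
    finally show ?thesis .
  qed
  then show ?thesis using double_choose_two[of n] double_choose_two[of e] by simp
qed

theorem proposition4p3:
  fixes d :: nat
  assumes "d > 2"
  shows "(\<forall>s::nat. 2 \<le> s \<and> s \<le> d - 1 \<longrightarrow>
            (Max (genera_of_length d s) < min_genus (s + 1) - 1 \<longleftrightarrow>
             (2 * real d + 1 - sqrt (8 * real d - 15)) / 2 < real s \<and> s \<le> d - 1))
       \<and> (\<forall>s::nat. (2 * real d + 1 - sqrt (8 * real d - 15)) / 2 < real s \<and> s \<le> d - 1 \<longrightarrow>
            {Max (genera_of_length d s) + 1 .. min_genus (s + 1) - 1} \<subseteq> gaps d)"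
proof (intro conjI allI impI)
  fix s :: nat
  assume s: "2 \<le> s \<and> s \<le> d - 1"
  define n where "n = s - 1"
  define e where "e = d - s"
  have ne: "1 \<le> n" "1 \<le> e" "s = Suc n" "d = Suc n + e"
    using s assms by (auto simp: n_def e_def)
  have fin: "finite (genera_of_length d s)"
    using finite_genera_of_length ne by simp
  have wit: "int ((n choose 2) + (min e n choose 2)) \<in> genera_of_length d s"
    using genera_of_length_witness ne by simp
  have up: "g \<le> int ((n choose 2) + (e choose 2))" if "g \<in> genera_of_length d s" for g
    using that genus_of_length_bounds(3)[of _ d n] ne
    by (auto simp: genera_of_length_def O_sequences_of_length_def)
  have mg: "min_genus (s + 1) = int (n choose 2) + int n"
    using ne by (simp add: min_genus_def numeral_2_eq_2)
  have "Max (genera_of_length d s) < min_genus (s + 1) - 1 \<longleftrightarrow> (e choose 2) + 1 < n"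
  proof
    assume "(e choose 2) + 1 < n"
    moreover have "Max (genera_of_length d s) \<le> int ((n choose 2) + (e choose 2))"
      using fin wit up by (intro Max.boundedI) auto
    ultimately show "Max (genera_of_length d s) < min_genus (s + 1) - 1"
      unfolding mg by linarith
  next
    assume "Max (genera_of_length d s) < min_genus (s + 1) - 1"
    moreover have "int ((n choose 2) + (min e n choose 2)) \<le> Max (genera_of_length d s)"
      using fin wit by (rule Max_ge)
    ultimately have "int (min e n choose 2) < int n - 1"
      unfolding mg by linarith
    \<comment> \<open>For e > n the minimum is n, and \<open>n choose 2\<close> is never below n -
      1.\<close>
    then show "(e choose 2) + 1 < n"
      using pred_le_choose_two[of n] by (cases "e \<le> n") (auto simp: min_def)
  qed
  then show "Max (genera_of_length d s) < min_genus (s + 1) - 1 \<longleftrightarrow>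
      (2 * real d + 1 - sqrt (8 * real d - 15)) / 2 < real s \<and> s \<le> d - 1"
    using threshold_iff_choose_two[OF ne(1,2)] s ne by simp
next
  fix s :: nat
  assume s: "(2 * real d + 1 - sqrt (8 * real d - 15)) / 2 < real s \<and> s \<le> d - 1"
  have thr: "(d - s) * (d - s) + (d - s) + 4 < 2 * d"
    using s assms by (subst threshold_iff[symmetric]) auto
  \<comment> \<open>The second claim states no lower bound on s. For s \<le> 1 the number
    \<open>d - s\<close> is at least d - 1 \<ge> 2, and its square already reaches 2(d - 1), against
    \<open>thr\<close>.\<close>
  have "2 \<le> s"
  proof (rule ccontr)
    assume "\<not> 2 \<le> s"
    then have "d - 1 \<le> d - s" by simp
    moreover from this have "2 * (d - 1) \<le> (d - s) * (d - s)"
      using assms by (intro mult_mono) auto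
    ultimately show False using thr by linarith
  qed
  define n where "n = s - 1"
  define e where "e = d - s"
  have ne: "1 \<le> n" "1 \<le> e" "s = Suc n" "d = Suc n + e"
    using s \<open>2 \<le> s\<close> assms by (auto simp: n_def e_def)
  have cond: "(e choose 2) + 1 < n"
    using threshold_iff_choose_two[OF ne(1,2)] s ne by simp
  \<comment> \<open>Ensures that the minimum in the witness is e, so that the maximum reaches the
    value with which shorter sequences are compared.\<close>
  have "e \<le> n"
  proof (rule ccontr)
    assume "\<not> e \<le> n"
    then have "n choose 2 \<le> e choose 2" by (intro binomial_right_mono) auto
    then show False using cond pred_le_choose_two[of n] by linarith
  qed
  have max: "int ((n choose 2) + (e choose 2)) \<le> Max (genera_of_length d s)"
    using genera_of_length_witness[OF ne(1,2)] finite_genera_of_length ne \<open>e \<le> n\<close>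
    by (intro Max_ge) (auto simp: min_def)
  show "{Max (genera_of_length d s) + 1 .. min_genus (s + 1) - 1} \<subseteq> gaps d"
  proof
    fix x
    assume "x \<in> {Max (genera_of_length d s) + 1 .. min_genus (s + 1) - 1}"
    then have x: "Max (genera_of_length d s) < x" "x < int (s choose 2)"
      by (auto simp: min_genus_def)
    have "s choose 2 \<le> (d - 1) choose 2"
      using s by (intro binomial_right_mono) auto
    then have "x \<in> genus_range d"
      using x max by (simp add: genus_range_def)
    moreover have "x \<notin> genera d"
    proof
      assume "x \<in> genera d"
      then obtain h where h: "h \<in> O_sequences d" and xh: "x = genus h"
        by (auto simp: genera_def)
      \<comment> \<open>Length 1 forces d = 1; as d > 2, this yields p \<ge> 1 in the case of
        shorter sequences.\<close>
      obtain p where p: "seq_length h = Suc p" and dp: "p = 0 \<Longrightarrow> d = 1"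
        using finite_O_sequence_excess[OF h] by (metis One_nat_def add.right_neutral lessThan_0 sum.empty)
      consider "n < p" | "p = n" | "p < n" by linarith
      then show False
      proof cases
        case 1
        \<comment> \<open>A longer sequence has p \<ge> s, so its genus is at least
          \<open>s choose 2\<close>, beyond x.\<close>
        then have "s choose 2 \<le> p choose 2"
          using ne by (intro binomial_right_mono) auto
        then show False using x xh genus_of_length_bounds(2)[OF h p] by simp
      next
        case 2
        then have "x \<in> genera_of_length d s"
          using h p xh ne by (auto simp: genera_of_length_def O_sequences_of_length_def)
        then have "x \<le> Max (genera_of_length d s)"
          using finite_genera_of_length ne by (intro Max_ge) auto
        then show False using x by simp
      next
        case 3
        have "1 \<le> p" using dp assms by (cases "p = 0") auto
        then have "genus h \<le> int ((n choose 2) + (e choose 2))"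
          using genus_le_of_shorter[of h n e p] h p 3 cond ne by simp
        then show False using x xh max by simp
      qed
    qed
    ultimately show "x \<in> gaps d" by (simp add: gaps_def)
  qed
qed

end
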